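(* Let $a<0$ and $b<0$ be integers. For the non-commutative frieze subring $(a,b)_{\mathbb{Z}}^{\circ}$ of the Lipschitz quaternion ring $(a,b)_{\mathbb{Z}}$ we have $$(a,b)_{\mathbb{Z}}^{\circ}=\begin{cases}\mathbb{Z} & \text{if } a\le-4 \text{ and } b\le-4,\\ (a,b)_{\mathbb{Z}} & \text{if } a\ge-3 \text{ and } b\ge-3.\end{cases}$$
   Context: For non-zero integers $a,b$, the quaternion algebra $(a,b)_{\mathbb{Q}}$ is the 4-dimensional associative $\mathbb{Q}$-algebra with basis $1,\mathrm{i},\mathrm{j},\mathrm{k}$ and relations $\mathrm{i}^2=a$, $\mathrm{j}^2=b$, $\mathrm{i}\mathrm{j}=\mathrm{k}=-\mathrm{j}\mathrm{i}$. For $a,b<0$ it is a division ring. The Lipschitz subring (Lipschitz quaternion ring) is $(a,b)_{\mathbb{Z}}=\{\alpha+\beta\mathrm{i}+\gamma\mathrm{j}+\delta\mathrm{k} : \alpha,\beta,\gamma,\delta\in\mathbb{Z}\}$. Non-commutative friezes. Let $D$ be a division ring and let $\mathcal{P}$ be an $m$-gon ($m\ge3$) with vertices $0,1,\dots,m-1$ in cyclic order (indices modulo $m$). Let $\mathrm{diag}(\mathcal{P})$ be the set of ordered pairs of distinct vertices (edges included, both orientations). A non-commutative frieze over $D$ on $\mathcal{P}$ is a map $c:\mathrm{diag}(\mathcal{P})\to D\setminus\{0\}$, $(r,s)\mapsto c_{r,s}$, satisfying: (a) for all $r$: $c_{r+1,r+2}c_{r,r+2}^{-1}c_{r,r+1}=c_{r+1,r}c_{r+2,r}^{-1}c_{r+2,r+1}$;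 (b) for all $r,s$ with $r,r+1,s,s+1$ pairwise distinct: $c_{s,r}=c_{s,s+1}c_{r+1,s+1}^{-1}c_{r+1,r}+c_{s,r+1}c_{s+1,r+1}^{-1}c_{s+1,r}$, $c_{r,s}=c_{r,r+1}c_{s+1,r+1}^{-1}c_{s+1,s}+c_{r,s+1}c_{r+1,s+1}^{-1}c_{r+1,s}$, $c_{r+1,s+1}=c_{r+1,r}c_{s,r}^{-1}c_{s,s+1}+c_{r+1,s}c_{r,s}^{-1}c_{r,s+1}$, $c_{s+1,r+1}=c_{s+1,s}c_{r,s}^{-1}c_{r,r+1}+c_{s+1,r}c_{s,r}^{-1}c_{s,r+1}$. The boundary entries are the $c_{r,r+1}$ and $c_{r+1,r}$. The non-commutative frieze subring $(a,b)_{\mathbb{Z}}^{\circ}$ is the subring of $(a,b)_{\mathbb{Z}}$ generated by all entries of all non-commutative friezes over the division ring $(a,b)_{\mathbb{Q}}$, on $m$-gons for all $m\ge3$, such that all entries lie in $(a,b)_{\mathbb{Z}}\setminus\{0\}$ and all boundary entries equal $1$. *)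

theory Defs
  imports Complex_Main "HOL-Algebra.Generated_Rings"
begin

text \<open>
  The quaternion algebra \<open>(a,b)\<^sub>\<rat>\<close>. An element is given by its rational coordinates with
  respect to the basis \<open>1, i, j, k\<close>. The algebra depends on \<open>a\<close> and \<open>b\<close>, so it is a ring record
  over one common type of coordinate vectors. The multiplication is the bilinear extension of
  \<open>i\<^sup>2 = a\<close>, \<open>j\<^sup>2 = b\<close>, \<open>i j = k = - j i\<close>, which force
  \<open>k\<^sup>2 = - a b\<close>, \<open>i k = a j = - k i\<close> and \<open>k j = b i = - j k\<close>.
\<close>

datatype quat = Quat (quat_1: rat) (quat_i: rat) (quat_j: rat) (quat_k: rat)

fun quat_add :: "quat \<Rightarrow> quat \<Rightarrow> quat" where
  "quat_add (Quat x0 x1 x2 x3) (Quat y0 y1 y2 y3) = Quat (x0 + y0) (x1 + y1) (x2 + y2) (x3 + y3)"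

fun quat_mult :: "rat \<Rightarrow> rat \<Rightarrow> quat \<Rightarrow> quat \<Rightarrow> quat" where
  "quat_mult a b (Quat x0 x1 x2 x3) (Quat y0 y1 y2 y3) =
     Quat (x0 * y0 + a * x1 * y1 + b * x2 * y2 - a * b * x3 * y3)
          (x0 * y1 + x1 * y0 - b * x2 * y3 + b * x3 * y2)
          (x0 * y2 + x2 * y0 + a * x1 * y3 - a * x3 * y1)
          (x0 * y3 + x3 * y0 + x1 * y2 - x2 * y1)"

definition quaternion_algebra :: "int \<Rightarrow> int \<Rightarrow> quat ring" where
  "quaternion_algebra a b =
     \<lparr>carrier = UNIV, mult = quat_mult (of_int a) (of_int b), one = Quat 1 0 0 0,
      zero = Quat 0 0 0 0, add = quat_add\<rparr>"

definition lipschitz_ring :: "int \<Rightarrow> int \<Rightarrow> quat ring" where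
  "lipschitz_ring a b =
     (quaternion_algebra a b)
       \<lparr>carrier := {Quat (of_int \<alpha>) (of_int \<beta>) (of_int \<gamma>) (of_int \<delta>) | \<alpha> \<beta> \<gamma> \<delta>. True}\<rparr>"

definition quat_integers :: "quat set" where
  "quat_integers = {Quat (of_int n) 0 0 0 | n. True}"

text \<open>Division rings, not assumed commutative (the locale \<^locale>\<open>field\<close> of HOL-Algebra is).\<close>

locale skew_field = ring D for D (structure) +
  assumes skew_field_Units: "Units D = carrier D - {\<zero>}"

text \<open>
  The vertices of the \<open>m\<close>-gon are \<open>0, \<dots>, m - 1\<close>, and \<open>c\<close> matters only on pairs in \<open>diag m\<close>.
  The abbreviation \<open>nxt m r\<close> is the vertex following \<open>r\<close>.
\<close>

definition diag :: "nat \<Rightarrow> (nat \<times> nat) set" where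
  "diag m = {(r, s). r < m \<and> s < m \<and> r \<noteq> s}"

abbreviation nxt :: "nat \<Rightarrow> nat \<Rightarrow> nat" where
  "nxt m r \<equiv> (r + 1) mod m"

locale nc_frieze = skew_field D for D (structure) +
  fixes m :: nat and c :: "nat \<Rightarrow> nat \<Rightarrow> 'a"
  assumes three_le: "3 \<le> m"
    and entry_nonzero: "\<And>r s. (r, s) \<in> diag m \<Longrightarrow> c r s \<in> carrier D - {\<zero>}"
    and triangle: "\<And>r r1 r2. \<lbrakk>r < m; r1 = nxt m r; r2 = nxt m r1\<rbrakk> \<Longrightarrow>
      c r1 r2 \<otimes> inv (c r r2) \<otimes> c r r1 = c r1 r \<otimes> inv (c r2 r) \<otimes> c r2 r1"
    and exchange: "\<And>r r1 s s1.
      \<lbrakk>r < m; s < m; r1 = nxt m r; s1 = nxt m s; distinct [r, r1, s, s1]\<rbrakk> \<Longrightarrow>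
      c s r = c s s1 \<otimes> inv (c r1 s1) \<otimes> c r1 r \<oplus> c s r1 \<otimes> inv (c s1 r1) \<otimes> c s1 r \<and>
      c r s = c r r1 \<otimes> inv (c s1 r1) \<otimes> c s1 s \<oplus> c r s1 \<otimes> inv (c r1 s1) \<otimes> c r1 s \<and>
      c r1 s1 = c r1 r \<otimes> inv (c s r) \<otimes> c s s1 \<oplus> c r1 s \<otimes> inv (c r s) \<otimes> c r s1 \<and>
      c s1 r1 = c s1 s \<otimes> inv (c r s) \<otimes> c r r1 \<oplus> c s1 r \<otimes> inv (c s r) \<otimes> c s r1"

definition lipschitz_frieze :: "int \<Rightarrow> int \<Rightarrow> nat \<Rightarrow> (nat \<Rightarrow> nat \<Rightarrow> quat) \<Rightarrow> bool" where
  "lipschitz_frieze a b m c \<longleftrightarrow>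
     nc_frieze (quaternion_algebra a b) m c \<and>
     (\<forall>(r, s) \<in> diag m. c r s \<in> carrier (lipschitz_ring a b) - {\<zero>\<^bsub>lipschitz_ring a b\<^esub>}) \<and>
     (\<forall>r < m. c r (nxt m r) = \<one>\<^bsub>lipschitz_ring a b\<^esub> \<and> c (nxt m r) r = \<one>\<^bsub>lipschitz_ring a b\<^esub>)"

definition frieze_subring :: "int \<Rightarrow> int \<Rightarrow> quat set" where
  "frieze_subring a b =
     generate_ring (lipschitz_ring a b)
       {c r s | m c r s. lipschitz_frieze a b m c \<and> (r, s) \<in> diag m}"

subsection \<open>Sanity checks\<close>

lemma quaternion_relations:
  assumes "i = Quat 0 1 0 0" "j = Quat 0 0 1 0" "k = Quat 0 0 0 1"
  shows "i \<otimes>\<^bsub>quaternion_algebra a b\<^esub> i = Quat (of_int a) 0 0 0"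
    and "j \<otimes>\<^bsub>quaternion_algebra a b\<^esub> j = Quat (of_int b) 0 0 0"
    and "i \<otimes>\<^bsub>quaternion_algebra a b\<^esub> j = k"
    and "j \<otimes>\<^bsub>quaternion_algebra a b\<^esub> i = Quat 0 0 0 (- 1)"
  using assms by (simp_all add: quaternion_algebra_def)

lemma quat_mult_assoc:
  "quat_mult a b (quat_mult a b x y) z = quat_mult a b x (quat_mult a b y z)"
  by (cases x; cases y; cases z) (simp add: algebra_simps)

lemma quaternion_algebra_ring: "ring (quaternion_algebra a b)"
proof (rule ringI)
  show "abelian_group (quaternion_algebra a b)"
  proof (rule abelian_groupI)
    fix x y z
    show "x \<oplus>\<^bsub>quaternion_algebra a b\<^esub> y \<oplus>\<^bsub>quaternion_algebra a b\<^esub> z =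
        x \<oplus>\<^bsub>quaternion_algebra a b\<^esub> (y \<oplus>\<^bsub>quaternion_algebra a b\<^esub> z)"
      by (cases x; cases y; cases z) (simp add: quaternion_algebra_def)
    show "x \<oplus>\<^bsub>quaternion_algebra a b\<^esub> y = y \<oplus>\<^bsub>quaternion_algebra a b\<^esub> x"
      by (cases x; cases y) (simp add: quaternion_algebra_def)
    show "\<zero>\<^bsub>quaternion_algebra a b\<^esub> \<oplus>\<^bsub>quaternion_algebra a b\<^esub> x = x"
      by (cases x) (simp add: quaternion_algebra_def)
    show "\<exists>y\<in>carrier (quaternion_algebra a b).
        y \<oplus>\<^bsub>quaternion_algebra a b\<^esub> x = \<zero>\<^bsub>quaternion_algebra a b\<^esub>"
      by (rule bexI[of _ "Quat (- quat_1 x) (- quat_i x) (- quat_j x) (- quat_k x)"]; cases x)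
        (simp_all add: quaternion_algebra_def)
  qed (simp_all add: quaternion_algebra_def)
  show "monoid (quaternion_algebra a b)"
  proof (rule monoidI)
    fix x y z
    show "x \<otimes>\<^bsub>quaternion_algebra a b\<^esub> y \<otimes>\<^bsub>quaternion_algebra a b\<^esub> z =
        x \<otimes>\<^bsub>quaternion_algebra a b\<^esub> (y \<otimes>\<^bsub>quaternion_algebra a b\<^esub> z)"
      by (simp add: quaternion_algebra_def quat_mult_assoc)
    show "\<one>\<^bsub>quaternion_algebra a b\<^esub> \<otimes>\<^bsub>quaternion_algebra a b\<^esub> x = x"
      by (cases x) (simp add: quaternion_algebra_def)
    show "x \<otimes>\<^bsub>quaternion_algebra a b\<^esub> \<one>\<^bsub>quaternion_algebra a b\<^esub> = x"
      by (cases x) (simp add: quaternion_algebra_def)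
  qed (simp_all add: quaternion_algebra_def)
next
  fix x y z
  show "(x \<oplus>\<^bsub>quaternion_algebra a b\<^esub> y) \<otimes>\<^bsub>quaternion_algebra a b\<^esub> z =
      x \<otimes>\<^bsub>quaternion_algebra a b\<^esub> z \<oplus>\<^bsub>quaternion_algebra a b\<^esub> y \<otimes>\<^bsub>quaternion_algebra a b\<^esub> z"
    by (cases x; cases y; cases z) (simp add: quaternion_algebra_def algebra_simps)
  show "z \<otimes>\<^bsub>quaternion_algebra a b\<^esub> (x \<oplus>\<^bsub>quaternion_algebra a b\<^esub> y) =
      z \<otimes>\<^bsub>quaternion_algebra a b\<^esub> x \<oplus>\<^bsub>quaternion_algebra a b\<^esub> z \<otimes>\<^bsub>quaternion_algebra a b\<^esub> y"
    by (cases x; cases y; cases z) (simp add: quaternion_algebra_def algebra_simps)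
qed

lemma quaternion_algebra_skew_field:
  assumes "a < 0" "b < 0"
  shows "skew_field (quaternion_algebra a b)"
proof -
  let ?a = "of_int a :: rat" and ?b = "of_int b :: rat"
  have ab: "?a < 0" "?b < 0" using assms by simp_all
  have inverse: "\<exists>y. quat_mult ?a ?b y x = Quat 1 0 0 0 \<and> quat_mult ?a ?b x y = Quat 1 0 0 0"
    if "x \<noteq> Quat 0 0 0 0" for x
  proof (cases x)
    case (Quat x0 x1 x2 x3)
    define N where "N = x0 * x0 + (- ?a) * (x1 * x1) + (- ?b) * (x2 * x2) + ?a * ?b * (x3 * x3)"
    have nn: "0 \<le> x0 * x0" "0 \<le> (- ?a) * (x1 * x1)" "0 \<le> (- ?b) * (x2 * x2)"
        "0 \<le> ?a * ?b * (x3 * x3)"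
      using ab by (simp_all add: mult_le_0_iff zero_le_mult_iff)
    have "N \<noteq> 0"
    proof
      assume "N = 0"
      then have "x0 * x0 = 0" "(- ?a) * (x1 * x1) = 0" "(- ?b) * (x2 * x2) = 0"
          "?a * ?b * (x3 * x3) = 0"
        using nn unfolding N_def by linarith+
      then show False using ab that Quat by simp
    qed
    define M where "M = inverse N"
    from \<open>N \<noteq> 0\<close> have "N * M = 1" by (simp add: M_def)
    then have "x0 * x0 * M - ?a * x1 * x1 * M - ?b * x2 * x2 * M
        + ?a * ?b * x3 * x3 * M = 1"
      by (simp add: N_def algebra_simps)
    then show ?thesis
      unfolding Quat
      by (intro exI[of _ "Quat (x0 * M) (- x1 * M) (- x2 * M)
            (- x3 * M)"])
        (simp add: algebra_simps)
  qed
  have zero: "quat_mult ?a ?b y (Quat 0 0 0 0) = Quat 0 0 0 0" for y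
    by (cases y) simp
  interpret ring "quaternion_algebra a b" by (rule quaternion_algebra_ring)
  show ?thesis
    by unfold_locales
      (use inverse zero in \<open>auto simp: Units_def quaternion_algebra_def\<close>)
qed

lemma lipschitz_subring:
  "subring (carrier (lipschitz_ring a b)) (quaternion_algebra a b)"
proof -
  interpret Q: ring "quaternion_algebra a b" by (rule quaternion_algebra_ring)
  let ?L = "carrier (lipschitz_ring a b)"
  have in_L: "Quat x0 x1 x2 x3 \<in> ?L \<longleftrightarrow> x0 \<in> \<int> \<and> x1 \<in> \<int> \<and> x2 \<in> \<int> \<and> x3 \<in> \<int>" for x0 x1 x2 x3
    by (auto simp: lipschitz_ring_def Ints_def)
  have uminus: "\<ominus>\<^bsub>quaternion_algebra a b\<^esub> Quat x0 x1 x2 x3 = Quat (- x0) (- x1) (- x2) (- x3)"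
    for x0 x1 x2 x3
    by (rule Q.minus_equality) (simp_all add: quaternion_algebra_def)
  show ?thesis
  proof (rule Q.subringI)
    show "?L \<subseteq> carrier (quaternion_algebra a b)" by (simp add: quaternion_algebra_def)
    show "\<one>\<^bsub>quaternion_algebra a b\<^esub> \<in> ?L"
      by (simp add: quaternion_algebra_def in_L)
  next
    fix x assume "x \<in> ?L"
    then show "\<ominus>\<^bsub>quaternion_algebra a b\<^esub> x \<in> ?L"
      by (cases x) (simp add: in_L uminus)
  next
    fix x y assume xy: "x \<in> ?L" "y \<in> ?L"
    then show "x \<otimes>\<^bsub>quaternion_algebra a b\<^esub> y \<in> ?L"
      by (cases x; cases y) (simp add: in_L quaternion_algebra_def)
    from xy show "x \<oplus>\<^bsub>quaternion_algebra a b\<^esub> y \<in> ?L"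
      by (cases x; cases y) (simp add: in_L quaternion_algebra_def)
  qed
qed

end

theory Submission
  imports Defs
begin

text \<open>
  The theorem has two independent halves. The link between them is the quiddity cycle
  \<open>q\<^sub>s = c\<^sub>s\<^sub>-\<^sub>1\<^sub>,\<^sub>s\<^sub>+\<^sub>1\<close> of a frieze with unit boundary.

  When \<open>a, b \<le> - 4\<close>, every frieze entry is an ordinary integer, by a non-commutative version of
  the ear argument of Conway and Coxeter. First, the exchange relations are linear in disguise: in
  any skew field the entries seen from a vertex \<open>r\<close> satisfy
  \<open>c\<^sub>r\<^sub>,\<^sub>s\<^sub>+\<^sub>1 = c\<^sub>r\<^sub>,\<^sub>s q\<^sub>s - c\<^sub>r\<^sub>,\<^sub>s\<^sub>-\<^sub>1\<close> (lemma \<open>linear_recurrence\<close>). The norm form is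
  multiplicative and satisfies Cauchy-Schwarz, so its square root is a norm. If every
  \<open>q\<^sub>s\<close> had absolute value at least 2, the sequence \<open>0, 1, \<dots>\<close> of entries seen from \<open>r\<close> would
  increase strictly (lemma \<open>quat_norm_grows\<close>) and could not come back to the value 1 at the
  other neighbour of \<open>r\<close>. So some \<open>q\<^sub>s\<close> has norm below 4. For \<open>a, b \<le> - 4\<close> the only nonzero
  elements of the Lipschitz ring with this property are 1 and -1, because a nonzero coordinate at
  \<open>i\<close>, \<open>j\<close> or \<open>k\<close> contributes at least 4 to the norm. With \<open>q\<^sub>s = \<plusminus>1\<close> the recurrence can be solved for the entry
  at \<open>s\<close>, the vertex \<open>s\<close> can be removed, and a recurrence of the same shape, up to signs, survives
  on the smaller polygon. Induction removes all vertices but the two at the ends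
  (lemma \<open>unit_path_integral\<close>).

  When \<open>a, b \<ge> - 3\<close>, the ring contains \<open>i\<close> and \<open>j\<close>, and these generate everything. If
  \<open>p q = q p = 2\<close>, then \<open>p, q, p, q\<close> is the quiddity cycle of a frieze on the square; if
  \<open>p q = q p = 3\<close>, then \<open>p, q, p, q, p, q\<close> is one on the hexagon. Take \<open>p, q = 1 \<plusminus> e\<close> when the
  imaginary unit \<open>e\<close> has square -1, and \<open>p, q = \<plusminus>e\<close> when its square is -2 or -3.
\<close>

section \<open>Unit-boundary friezes over a skew field\<close>

context skew_field
begin

lemma nonzero_Units: "x \<in> carrier D \<Longrightarrow> x \<noteq> \<zero> \<Longrightarrow> x \<in> Units D"
  by (simp add: skew_field_Units)

lemma Units_r_cancel:
  assumes "x \<in> Units D" "y \<in> carrier D" "z \<in> carrier D"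
  shows "y \<otimes> x = z \<otimes> x \<longleftrightarrow> y = z"
  by (metis Units_closed Units_inv_closed Units_r_inv assms m_assoc r_one)

text \<open>
  Each exchange relation has the shape \<open>p = x\<^sup>-\<^sup>1 + u y\<^sup>-\<^sup>1 w\<close>, once boundary entries are 1. The
  triangle relation for \<open>x, u, y\<close> lets \<open>x\<close> pass through \<open>u\<close>, and the relation becomes a
  Ptolemy relation without inverses. Which of the two sides \<open>x\<close> may be multiplied on depends on
  the triangle that is available, so both versions are needed.
\<close>

lemma clear_denominator_left:
  assumes "x \<in> Units D" "y \<in> Units D" "u \<in> carrier D" "v \<in> carrier D" "w \<in> carrier D"
    and "p = inv x \<oplus> u \<otimes> inv y \<otimes> w" and "x \<otimes> u = v \<otimes> y"
  shows "x \<otimes> p = \<one> \<oplus> v \<otimes> w"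
proof -
  have "x \<otimes> p = \<one> \<oplus> (x \<otimes> u) \<otimes> inv y \<otimes> w"
    using assms(1-6) by (simp add: r_distr m_assoc Units_closed)
  also have "\<dots> = \<one> \<oplus> v \<otimes> w"
    using assms by (simp add: m_assoc Units_closed)
  finally show ?thesis .
qed

lemma clear_denominator_right:
  assumes "x \<in> Units D" "y \<in> Units D" "u \<in> carrier D" "v \<in> carrier D" "w \<in> carrier D"
    and "p = inv x \<oplus> w \<otimes> inv y \<otimes> u" and "u \<otimes> x = y \<otimes> v"
  shows "p \<otimes> x = \<one> \<oplus> w \<otimes> v"
proof -
  have "p \<otimes> x = \<one> \<oplus> w \<otimes> (inv y \<otimes> (u \<otimes> x))"
    using assms(1-6) by (simp add: l_distr m_assoc Units_closed)
  also have "\<dots> = \<one> \<oplus> w \<otimes> v"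
    using assms by (simp add: Units_closed m_assoc[symmetric])
  finally show ?thesis .
qed

text \<open>
  Consider the quadrilateral \<open>r, r+1, s, s+1\<close> with its opposite edges \<open>(r, r+1)\<close> and \<open>(s, s+1)\<close>
  equal to 1. Here \<open>A, B, C, E\<close> stand for
  \<open>c\<^sub>r\<^sub>,\<^sub>s\<close>, \<open>c\<^sub>r\<^sub>+\<^sub>1\<^sub>,\<^sub>s\<^sub>+\<^sub>1\<close>, \<open>c\<^sub>r\<^sub>,\<^sub>s\<^sub>+\<^sub>1\<close>, \<open>c\<^sub>r\<^sub>+\<^sub>1\<^sub>,\<^sub>s\<close>,
  and a prime reverses the diagonal. Of the four triangles in the quadrilateral, the relations of the two that
  contain the diagonal \<open>E\<close> imply the relations of the two that contain \<open>C\<close>.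
\<close>

lemma triangle_across_quadrilateral:
  assumes U: "A \<in> Units D" "A' \<in> Units D" "B \<in> Units D" "B' \<in> Units D"
      "C \<in> Units D" "C' \<in> Units D" "E \<in> Units D" "E' \<in> Units D"
    and AA: "A' \<otimes> E = E' \<otimes> A" and BB: "B \<otimes> E' = E \<otimes> B'"
    and 1: "A' = inv B \<oplus> E' \<otimes> inv B' \<otimes> C'"
    and 2: "A = inv B' \<oplus> C \<otimes> inv B \<otimes> E"
    and 3: "B = inv A' \<oplus> E \<otimes> inv A \<otimes> C"
    and 4: "B' = inv A \<oplus> C' \<otimes> inv A' \<otimes> E'"
  shows "B' \<otimes> C = C' \<otimes> B" and "C \<otimes> A' = A \<otimes> C'"
proof -
  note cl = U[THEN Units_closed]
  have 5: "B \<otimes> A' = \<one> \<oplus> E \<otimes> C'"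
    by (rule clear_denominator_left[OF _ _ _ _ _ 1 BB]) (use U cl in auto)
  have 6: "A \<otimes> B' = \<one> \<oplus> C \<otimes> E'"
    by (rule clear_denominator_right[OF _ _ _ _ _ 2 BB[symmetric]]) (use U cl in auto)
  have 7: "A' \<otimes> B = \<one> \<oplus> E' \<otimes> C"
    by (rule clear_denominator_left[OF _ _ _ _ _ 3 AA]) (use U cl in auto)
  have 8: "B' \<otimes> A = \<one> \<oplus> C' \<otimes> E"
    by (rule clear_denominator_right[OF _ _ _ _ _ 4 AA[symmetric]]) (use U cl in auto)
  \<comment> \<open>The products \<open>B A' B\<close> and \<open>A B' A\<close>, each expanded in two ways, give the two claims.\<close>
  have "B \<oplus> E \<otimes> (B' \<otimes> C) = B \<otimes> (\<one> \<oplus> E' \<otimes> C)"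
    using cl by (simp add: r_distr m_assoc[symmetric] BB)
  also have "\<dots> = (\<one> \<oplus> E \<otimes> C') \<otimes> B"
    using cl by (simp add: 5[symmetric] 7[symmetric] m_assoc)
  also have "\<dots> = B \<oplus> E \<otimes> (C' \<otimes> B)"
    using cl by (simp add: l_distr m_assoc)
  finally show "B' \<otimes> C = C' \<otimes> B" using cl U by simp
  have "A \<oplus> (A \<otimes> C') \<otimes> E = A \<otimes> (\<one> \<oplus> C' \<otimes> E)"
    using cl by (simp add: r_distr m_assoc)
  also have "\<dots> = (\<one> \<oplus> C \<otimes> E') \<otimes> A"
    using cl by (simp add: 6[symmetric] 8[symmetric] m_assoc)
  also have "\<dots> = A \<oplus> (C \<otimes> A') \<otimes> E"
    using cl by (simp add: l_distr m_assoc AA)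
  finally show "C \<otimes> A' = A \<otimes> C'" using cl U by (simp add: Units_r_cancel)
qed

end

locale unit_frieze = nc_frieze +
  assumes boundary: "r < m \<Longrightarrow> c r (nxt m r) = \<one> \<and> c (nxt m r) r = \<one>"
begin

text \<open>
  Vertices are lifted to all natural numbers, so that the next vertex is the successor, and
  the diagonal is filled with zeros, as the linear recurrence requires.
\<close>

definition entry :: "nat \<Rightarrow> nat \<Rightarrow> 'a" where
  "entry i j = (if i mod m = j mod m then \<zero> else c (i mod m) (j mod m))"

lemma mod_add_neq: "i < j \<Longrightarrow> j < m \<Longrightarrow> (r + i) mod m \<noteq> (r + j) mod m"
proof
  assume a: "i < j" "j < m" "(r + i) mod m = (r + j) mod m"
  then have "m dvd (r + j) - (r + i)" by (metis add_le_cancel_left less_imp_le mod_eq_dvd_iff_nat)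
  then show False using a by (auto dest: dvd_imp_le)
qed

lemma m_pos: "0 < m" using three_le by simp

lemma entry_diag: 
  "i mod m \<noteq> j mod m \<Longrightarrow>
     entry i j = c (i mod m) (j mod m) \<and> (i mod m, j mod m) \<in> diag m"
  using m_pos by (simp add: entry_def diag_def)

lemma entry_unit: "i mod m \<noteq> j mod m \<Longrightarrow> entry i j \<in> Units D"
  using entry_diag[of i j] entry_nonzero by (metis Diff_iff insertI1 nonzero_Units)

lemma entry_closed [simp]: "entry i j \<in> carrier D"
proof (cases "i mod m = j mod m")
  case False
  then show ?thesis by (intro Units_closed entry_unit)
qed (simp add: entry_def)

lemma entry_refl [simp]: "entry i i = \<zero>" by (simp add: entry_def)

lemma nxt_mod: "nxt m (i mod m) = Suc i mod m" by (simp add: mod_Suc_eq)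

lemma mod_Suc_neq: "i mod m \<noteq> Suc i mod m"
  using mod_add_neq[of 0 1 i] three_le by simp

lemma entry_Suc [simp]: "entry i (Suc i) = \<one>" "entry (Suc i) i = \<one>"
  using boundary[of "i mod m", unfolded nxt_mod] m_pos mod_Suc_neq[of i] by (simp_all add: entry_def)

text \<open>
  This is the given triangle relation when both edges are 1.
\<close>

lemma entry_symmetric_short: "entry i (Suc (Suc i)) = entry (Suc (Suc i)) i"
proof -
  have ne: "i mod m \<noteq> Suc (Suc i) mod m" using mod_add_neq[of 0 2 i] three_le by simp
  have "entry (Suc i) (Suc (Suc i)) \<otimes> inv (entry i (Suc (Suc i))) \<otimes> entry i (Suc i) =
      entry (Suc i) i \<otimes> inv (entry (Suc (Suc i)) i) \<otimes> entry (Suc (Suc i)) (Suc i)"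
    using triangle[OF _ nxt_mod[symmetric] nxt_mod[symmetric], of i] m_pos ne
      mod_Suc_neq[of i] mod_Suc_neq[of "Suc i"] by (simp add: entry_def)
  then have "inv (entry i (Suc (Suc i))) = inv (entry (Suc (Suc i)) i)"
    using ne entry_unit[of i "Suc (Suc i)"] entry_unit[of "Suc (Suc i)" i] by simp
  then show ?thesis using ne entry_unit[of i "Suc (Suc i)"] entry_unit[of "Suc (Suc i)" i]
    by (metis Units_inv_inv)
qed

lemma entry_exchange:
  assumes "distinct [r mod m, Suc r mod m, s mod m, Suc s mod m]"
  shows "entry s r = inv (entry (Suc r) (Suc s)) \<oplus>
      entry s (Suc r) \<otimes> inv (entry (Suc s) (Suc r)) \<otimes> entry (Suc s) r"
    "entry r s = inv (entry (Suc s) (Suc r)) \<oplus>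
      entry r (Suc s) \<otimes> inv (entry (Suc r) (Suc s)) \<otimes> entry (Suc r) s"
    "entry (Suc r) (Suc s) = inv (entry s r) \<oplus>
      entry (Suc r) s \<otimes> inv (entry r s) \<otimes> entry r (Suc s)"
    "entry (Suc s) (Suc r) = inv (entry r s) \<oplus>
      entry (Suc s) r \<otimes> inv (entry s r) \<otimes> entry s (Suc r)"
proof -
  have u: "entry s r \<in> Units D" "entry r s \<in> Units D"
      "entry (Suc r) (Suc s) \<in> Units D" "entry (Suc s) (Suc r) \<in> Units D"
    using assms by (auto intro!: entry_unit)
  have entry_as_c: "entry r s = c (r mod m) (s mod m)" "entry s r = c (s mod m) (r mod m)"
      "entry r (Suc s) = c (r mod m) (Suc s mod m)" "entry (Suc s) r = c (Suc s mod m) (r mod m)"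
      "entry (Suc r) s = c (Suc r mod m) (s mod m)" "entry s (Suc r) = c (s mod m) (Suc r mod m)"
      "entry (Suc r) (Suc s) = c (Suc r mod m) (Suc s mod m)"
      "entry (Suc s) (Suc r) = c (Suc s mod m) (Suc r mod m)"
      "entry r (Suc r) = c (r mod m) (Suc r mod m)" "entry (Suc r) r = c (Suc r mod m) (r mod m)"
      "entry s (Suc s) = c (s mod m) (Suc s mod m)" "entry (Suc s) s = c (Suc s mod m) (s mod m)"
    using assms by (auto simp: entry_def)
  have eqs: "entry s r = entry s (Suc s) \<otimes> inv (entry (Suc r) (Suc s)) \<otimes> entry (Suc r) r \<oplus>
        entry s (Suc r) \<otimes> inv (entry (Suc s) (Suc r)) \<otimes> entry (Suc s) r \<and>
      entry r s = entry r (Suc r) \<otimes> inv (entry (Suc s) (Suc r)) \<otimes> entry (Suc s) s \<oplus>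
        entry r (Suc s) \<otimes> inv (entry (Suc r) (Suc s)) \<otimes> entry (Suc r) s \<and>
      entry (Suc r) (Suc s) = entry (Suc r) r \<otimes> inv (entry s r) \<otimes> entry s (Suc s) \<oplus>
        entry (Suc r) s \<otimes> inv (entry r s) \<otimes> entry r (Suc s) \<and>
      entry (Suc s) (Suc r) = entry (Suc s) s \<otimes> inv (entry r s) \<otimes> entry r (Suc r) \<oplus>
        entry (Suc s) r \<otimes> inv (entry s r) \<otimes> entry s (Suc r)"
    unfolding entry_as_c
    by (rule exchange[OF _ _ nxt_mod[symmetric] nxt_mod[symmetric] assms]) (simp_all add: m_pos)
  have ones: "\<one> \<otimes> inv x \<otimes> \<one> = inv x" if "x \<in> Units D" for x
    using that by simp
  from eqs[unfolded entry_Suc ones[OF u(1)] ones[OF u(2)] ones[OF u(3)] ones[OF u(4)]]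
  show "entry s r = inv (entry (Suc r) (Suc s)) \<oplus>
      entry s (Suc r) \<otimes> inv (entry (Suc s) (Suc r)) \<otimes> entry (Suc s) r"
    "entry r s = inv (entry (Suc s) (Suc r)) \<oplus>
      entry r (Suc s) \<otimes> inv (entry (Suc r) (Suc s)) \<otimes> entry (Suc r) s"
    "entry (Suc r) (Suc s) = inv (entry s r) \<oplus>
      entry (Suc r) s \<otimes> inv (entry r s) \<otimes> entry r (Suc s)"
    "entry (Suc s) (Suc r) = inv (entry r s) \<oplus>
      entry (Suc s) r \<otimes> inv (entry s r) \<otimes> entry s (Suc r)"
    by blast+
qed

lemma edge_distinct:
  assumes "s = r + Suc d" "1 \<le> d" "d + 3 \<le> m"
  shows "distinct [r mod m, Suc r mod m, s mod m, Suc s mod m]"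
  using assms mod_add_neq[of 0 1 r] mod_add_neq[of 0 "Suc d" r] mod_add_neq[of 0 "Suc (Suc d)" r]
     mod_add_neq[of 1 "Suc d" r] mod_add_neq[of 1 "Suc (Suc d)" r]
     mod_add_neq[of "Suc d" "Suc (Suc d)" r]
  by simp

text \<open>
  The triangle relation is given for three consecutive vertices only. It spreads to every triangle
  with an edge of the polygon: the two conjuncts treat the triangles \<open>r, r+1, r+d+1\<close> and
  \<open>r, r+d, r+d+1\<close> together because the step across a quadrilateral uses one of each
  kind and produces one of each kind.
\<close>

lemma triangle_edge_apex:
  assumes "1 \<le> d" "d + 2 \<le> m"
  shows "entry (r + Suc d) (Suc r) \<otimes> entry r (r + Suc d) =
       entry (r + Suc d) r \<otimes> entry (Suc r) (r + Suc d) \<and>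
     entry r (Suc (r + d)) \<otimes> entry (r + d) r = entry r (r + d) \<otimes> entry (Suc (r + d)) r"
  using assms
proof (induction d arbitrary: r rule: dec_induct)
  case base
  show ?case by (simp add: entry_symmetric_short)
next
  case (step d)
  define s where "s = r + Suc d"
  have dis: "distinct [r mod m, Suc r mod m, s mod m, Suc s mod m]"
    by (rule edge_distinct[OF s_def]) (use step in auto)
  have 1: "entry s r \<otimes> entry (Suc r) s = entry s (Suc r) \<otimes> entry r s"
    using step.IH[of r] step.prems by (simp add: s_def)
  have 2: "entry (Suc r) (Suc s) \<otimes> entry s (Suc r) = entry (Suc r) s \<otimes> entry (Suc s) (Suc r)"
    using step.IH[of "Suc r"] step.prems by (simp add: s_def)
  have "entry (Suc s) (Suc r) \<otimes> entry r (Suc s) = entry (Suc s) r \<otimes> entry (Suc r) (Suc s)"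
     "entry r (Suc s) \<otimes> entry s r = entry r s \<otimes> entry (Suc s) r"
    by (rule triangle_across_quadrilateral[OF _ _ _ _ _ _ _ _ 1 2 entry_exchange[OF dis]];
      use dis in \<open>auto intro!: entry_unit\<close>)+
  then show ?case by (simp add: s_def)
qed

lemma ptolemy_forward:
  assumes "s = r + Suc d" "1 \<le> d" "d + 3 \<le> m"
  shows "entry s r \<otimes> entry (Suc r) (Suc s) = \<one> \<oplus> entry s (Suc r) \<otimes> entry r (Suc s)"
proof -
  note dis = edge_distinct[OF assms]
  show ?thesis
    by (rule clear_denominator_left[OF _ _ _ _ _ entry_exchange(3)[OF dis]])
      (use dis triangle_edge_apex[of d r] assms in \<open>auto intro!: entry_unit\<close>)
qed

lemma ptolemy_backward:
  assumes "s = r + Suc d" "d + 3 \<le> m"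
  shows "entry (Suc s) (Suc r) \<otimes> entry r s = \<one> \<oplus> entry (Suc s) r \<otimes> entry (Suc r) s"
proof (cases "d = 0")
  case True
  then show ?thesis using assms by simp
next
  case False
  then have dis: "distinct [r mod m, Suc r mod m, s mod m, Suc s mod m]"
    using edge_distinct[OF assms(1)] assms by simp
  show ?thesis
    by (rule clear_denominator_right[OF _ _ _ _ _ entry_exchange(4)[OF dis]])
      (use False dis triangle_edge_apex[of d r] assms in \<open>auto intro!: entry_unit\<close>)
qed

text \<open>
  Two Ptolemy relations show that \<open>c\<^sub>r\<^sub>,\<^sub>t\<^sup>-\<^sup>1 (c\<^sub>r\<^sub>,\<^sub>t\<^sub>+\<^sub>1 + c\<^sub>r\<^sub>,\<^sub>t\<^sub>-\<^sub>1)\<close> is the same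
  for \<open>r\<close> and \<open>r + 1\<close>. Starting at \<open>r = t - 1\<close>, where the value is the quiddity entry at \<open>t\<close>, this gives the value for every \<open>r\<close>.
\<close>

lemma linear_recurrence:
  assumes "s = r + k" "k + 3 \<le> m"
  shows "entry r (Suc (Suc s)) \<oplus> entry r s = entry r (Suc s) \<otimes> entry s (Suc (Suc s))"
  using assms
proof (induction k arbitrary: r)
  case 0
  then show ?case by simp
next
  case (Suc k)
  let ?t = "Suc s"
  let ?q = "entry s (Suc ?t)"
  have IH: "entry (Suc r) (Suc ?t) \<oplus> entry (Suc r) s = entry (Suc r) ?t \<otimes> ?q"
    using Suc by simp
  have p1: "entry ?t r \<otimes> entry (Suc r) (Suc ?t) = \<one> \<oplus> entry ?t (Suc r) \<otimes> entry r (Suc ?t)"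
    by (rule ptolemy_forward[of _ _ "Suc k"]) (use Suc.prems in auto)
  have p2: "entry ?t (Suc r) \<otimes> entry r s = \<one> \<oplus> entry ?t r \<otimes> entry (Suc r) s"
    by (rule ptolemy_backward[of _ _ k]) (use Suc.prems in auto)
  have tri: "entry ?t (Suc r) \<otimes> entry r ?t = entry ?t r \<otimes> entry (Suc r) ?t"
    using triangle_edge_apex[of "Suc k" r] Suc.prems by simp
  have "\<one> \<oplus> entry ?t (Suc r) \<otimes> (entry r (Suc ?t) \<oplus> entry r s) =
      (\<one> \<oplus> entry ?t (Suc r) \<otimes> entry r (Suc ?t)) \<oplus> entry ?t (Suc r) \<otimes> entry r s"
    by (simp add: r_distr a_assoc)
  also have "\<dots> = entry ?t r \<otimes> entry (Suc r) (Suc ?t) \<oplus> (\<one> \<oplus> entry ?t r \<otimes> entry (Suc r) s)"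
    by (simp add: p1 p2)
  also have "\<dots> = \<one> \<oplus> entry ?t r \<otimes> (entry (Suc r) (Suc ?t) \<oplus> entry (Suc r) s)"
    by (simp add: r_distr a_ac)
  also have "\<dots> = \<one> \<oplus> entry ?t (Suc r) \<otimes> (entry r ?t \<otimes> ?q)"
    by (simp add: IH m_assoc[symmetric] tri)
  finally have "entry ?t (Suc r) \<otimes> (entry r (Suc ?t) \<oplus> entry r s) =
      entry ?t (Suc r) \<otimes> (entry r ?t \<otimes> ?q)"
    by simp
  moreover have "entry ?t (Suc r) \<in> Units D"
    by (rule entry_unit) (use Suc.prems mod_add_neq[of 1 "Suc (Suc k)" r] in simp)
  ultimately show ?case by simp
qed

end

section \<open>The norm form of a quaternion algebra\<close>

text \<open>
  The additive structure does not depend on the parameters of the algebra, so it can live in a type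
  class; this gives linear rewriting for quaternions.
\<close>

instantiation quat :: ab_group_add
begin
definition "0 = Quat 0 0 0 0"
definition "x + y = quat_add x y"
definition "- x = Quat (- quat_1 x) (- quat_i x) (- quat_j x) (- quat_k x)"
definition "x - y =
  Quat (quat_1 x - quat_1 y) (quat_i x - quat_i y) (quat_j x - quat_j y) (quat_k x - quat_k y)"
instance
proof
  fix x y z :: quat
  show "x + y + z = x + (y + z)" by (cases x; cases y; cases z) (simp add: plus_quat_def)
  show "x + y = y + x" by (cases x; cases y) (simp add: plus_quat_def)
  show "0 + x = x" by (cases x) (simp add: plus_quat_def zero_quat_def)
  show "- x + x = 0" by (cases x) (simp add: plus_quat_def zero_quat_def uminus_quat_def)
  show "x - y = x + - y" by (cases x; cases y) (simp add: plus_quat_def minus_quat_def uminus_quat_def)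
qed
end

lemmas quat_group_defs = zero_quat_def plus_quat_def uminus_quat_def minus_quat_def

abbreviation quat_one :: quat where "quat_one \<equiv> Quat 1 0 0 0"

lemma quat_mult_one [simp]: "quat_mult a b x quat_one = x" "quat_mult a b quat_one x = x"
  by (cases x; simp)+

lemma quat_mult_zero [simp]: "quat_mult a b x 0 = 0" "quat_mult a b 0 x = 0"
  by (cases x; simp add: zero_quat_def)+

lemma quat_mult_uminus [simp]: "quat_mult a b x (- y) = - quat_mult a b x y"
    "quat_mult a b (- x) y = - quat_mult a b x y"
  by (cases x; cases y; simp add: quat_group_defs algebra_simps)+

lemma quat_mult_distrib: "quat_mult a b x (y + z) = quat_mult a b x y + quat_mult a b x z"
    "quat_mult a b (y + z) x = quat_mult a b y x + quat_mult a b z x"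
  by (cases x; cases y; cases z; simp add: quat_group_defs algebra_simps)+

lemma quat_mult_diff: "quat_mult a b x (y - z) = quat_mult a b x y - quat_mult a b x z"
    "quat_mult a b (y - z) x = quat_mult a b y x - quat_mult a b z x"
  by (cases x; cases y; cases z; simp add: quat_group_defs algebra_simps)+

definition quat_norm :: "rat \<Rightarrow> rat \<Rightarrow> quat \<Rightarrow> rat" where
  "quat_norm a b x = quat_1 x ^ 2 - a * quat_i x ^ 2 - b * quat_j x ^ 2 + a * b * quat_k x ^ 2"

lemma quat_norm_mult: "quat_norm a b (quat_mult a b x y) = quat_norm a b x * quat_norm a b y"
  by (cases x; cases y) (simp add: quat_norm_def power2_eq_square algebra_simps)

lemma quat_norm_uminus [simp]: "quat_norm a b (- x) = quat_norm a b x"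
  by (simp add: quat_norm_def quat_group_defs)

lemma quat_norm_nonneg: "a < 0 \<Longrightarrow> b < 0 \<Longrightarrow> 0 \<le> quat_norm a b x"
proof -
  assume "a < 0" "b < 0"
  then have "a * quat_i x ^ 2 \<le> 0" "b * quat_j x ^ 2 \<le> 0" "0 \<le> a * b * quat_k x ^ 2" "0 \<le> quat_1 x ^ 2"
    by (simp_all add: mult_le_0_iff zero_le_mult_iff)
  then show ?thesis unfolding quat_norm_def by linarith
qed

definition quat_inner :: "rat \<Rightarrow> rat \<Rightarrow> quat \<Rightarrow> quat \<Rightarrow> rat" where
  "quat_inner a b x y = quat_1 x * quat_1 y - a * quat_i x * quat_i y - b * quat_j x * quat_j y
     + a * b * quat_k x * quat_k y"

lemma quat_norm_diff:
  "quat_norm a b (x - y) = quat_norm a b x - 2 * quat_inner a b x y + quat_norm a b y"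
  by (simp add: quat_norm_def quat_inner_def quat_group_defs power2_eq_square algebra_simps)

text \<open>
  The inner product of \<open>x\<close> and \<open>y\<close> is the real part of the conjugate of \<open>x\<close> times \<open>y\<close>, and the square
  of a real part is at most the norm.
\<close>

lemma quat_cauchy_schwarz:
  assumes "a < 0" "b < 0"
  shows "(quat_inner a b x y)\<^sup>2 \<le> quat_norm a b x * quat_norm a b y"
proof -
  define x' where "x' = Quat (quat_1 x) (- quat_i x) (- quat_j x) (- quat_k x)"
  define z where "z = quat_mult a b x' y"
  have re: "quat_1 z = quat_inner a b x y"
    by (cases x; cases y) (simp add: z_def x'_def quat_inner_def)
  have "(quat_1 z)\<^sup>2 \<le> quat_norm a b z"
    using quat_norm_nonneg[OF assms, of "Quat 0 (quat_i z) (quat_j z) (quat_k z)"]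
    by (simp add: quat_norm_def)
  also have "\<dots> = quat_norm a b x * quat_norm a b y"
    by (simp add: z_def quat_norm_mult) (simp add: x'_def quat_norm_def)
  finally show ?thesis by (simp add: re)
qed

text \<open>
  With \<open>\<bar>x\<bar>\<close> for the square root of the norm, this is
  \<open>\<bar>x q - y\<bar> \<ge> 2 \<bar>x\<bar> - \<bar>y\<bar> > \<bar>x\<bar>\<close>. Over the rationals there are no square roots; the argument is
  squared instead.
\<close>

lemma quat_norm_grows:
  assumes ab: "a < 0" "b < 0" and q: "4 \<le> quat_norm a b q"
    and lt: "quat_norm a b y < quat_norm a b x"
  shows "quat_norm a b x < quat_norm a b (quat_mult a b x q - y)"
proof (rule ccontr)
  define X Y Z B where "X = quat_norm a b (quat_mult a b x q)" and "Y = quat_norm a b y"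
    and "Z = quat_norm a b x" and "B = quat_inner a b (quat_mult a b x q) y"
  have nonneg: "0 \<le> Y" using quat_norm_nonneg[OF ab] by (simp add: Y_def)
  have Z: "Y < Z" using lt by (simp add: Y_def Z_def)
  have X: "4 * Z \<le> X" using q Z nonneg by (simp add: X_def quat_norm_mult Z_def mult.commute)
  assume "\<not> ?thesis"
  then have "X - 2 * B + Y \<le> Z"
    by (simp add: quat_norm_diff X_def Y_def Z_def B_def)
  then have "(X + Y - Z)\<^sup>2 \<le> (2 * B)\<^sup>2"
    using X Z nonneg by (intro power_mono) auto
  also have "\<dots> \<le> 4 * (X * Y)"
    using quat_cauchy_schwarz[OF ab] by (simp add: X_def Y_def B_def power_mult_distrib)
  finally have "(X + Y - Z)\<^sup>2 \<le> 4 * (X * Y)" .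
  \<comment> \<open>The left side vanishes exactly when \<open>\<surd>X, \<surd>Y, \<surd>Z\<close> are the sides of a degenerate triangle
      (Heron); here \<open>\<surd>X > \<surd>Y + \<surd>Z\<close>. The right side is its expansion around \<open>X = 4 Z\<close>.\<close>
  moreover have "(X + Y - Z)\<^sup>2 - 4 * (X * Y) =
     (X - 4 * Z) * (X + 2 * Z - 2 * Y) + (9 * Z - Y) * (Z - Y)"
    by (simp add: power2_eq_square algebra_simps)
  moreover have "0 \<le> (X - 4 * Z) * (X + 2 * Z - 2 * Y)" "0 < (9 * Z - Y) * (Z - Y)"
    using X Z nonneg by (auto intro!: mult_nonneg_nonneg mult_pos_pos)
  ultimately show False by linarith
qed

section \<open>Cutting off vertices with a small entry\<close>

abbreviation quat_signs :: "quat set" where "quat_signs \<equiv> {quat_one, - quat_one}"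

lemma lipschitz_small_norm_sign:
  assumes "a \<le> - 4" "b \<le> - 4" and x: "x \<in> carrier (lipschitz_ring a b)" "x \<noteq> 0"
    and small: "quat_norm (of_int a) (of_int b) x < 4"
  shows "x \<in> quat_signs"
proof -
  obtain \<alpha> \<beta> \<gamma> \<delta> :: int where x_eq: "x = Quat (of_int \<alpha>) (of_int \<beta>) (of_int \<gamma>) (of_int \<delta>)"
    using x by (auto simp: lipschitz_ring_def)
  have "quat_norm (of_int a) (of_int b) x = of_int (\<alpha>\<^sup>2 + (- a) * \<beta>\<^sup>2 + (- b) * \<gamma>\<^sup>2 + (a * b) * \<delta>\<^sup>2)"
    by (simp add: x_eq quat_norm_def)
  then have lt: "\<alpha>\<^sup>2 + (- a) * \<beta>\<^sup>2 + (- b) * \<gamma>\<^sup>2 + (a * b) * \<delta>\<^sup>2 < 4"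
    using small by (metis of_int_less_numeral_iff)
  have "4 * 4 \<le> (- a) * (- b)" using assms by (intro mult_mono) auto
  then have ab: "4 \<le> a * b" by simp
  have big: "y = 0 \<or> 4 \<le> n * y\<^sup>2" if "4 \<le> n" for n y :: int
  proof (cases "y = 0")
    case False
    then have "1 \<le> y\<^sup>2" by (simp add: int_one_le_iff_zero_less)
    then have "4 * 1 \<le> n * y\<^sup>2" using that by (intro mult_mono) auto
    then show ?thesis by simp
  qed simp
  have nonneg: "0 \<le> \<alpha>\<^sup>2" "0 \<le> (- a) * \<beta>\<^sup>2" "0 \<le> (- b) * \<gamma>\<^sup>2" "0 \<le> (a * b) * \<delta>\<^sup>2"
    using assms ab by (simp_all add: mult_le_0_iff)
  have 0: "\<beta> = 0" "\<gamma> = 0" "\<delta> = 0"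
    using big[of "- a" \<beta>] big[of "- b" \<gamma>] big[of "a * b" \<delta>] ab lt nonneg assms by linarith+
  then have "\<alpha>\<^sup>2 < 2\<^sup>2" using lt by simp
  then have "\<bar>\<alpha>\<bar> < 2" by (metis abs_numeral power2_less_imp_less abs_ge_zero zero_le_numeral power2_abs)
  moreover have "\<alpha> \<noteq> 0" using x x_eq 0 by (simp add: zero_quat_def)
  ultimately have "\<alpha> = 1 \<or> \<alpha> = - 1" by linarith
  then show ?thesis by (auto simp: x_eq 0 uminus_quat_def)
qed

lemma quat_integers_closed:
  assumes "x \<in> quat_integers" "y \<in> quat_integers"
  shows "x + y \<in> quat_integers" "- x \<in> quat_integers" "x - y \<in> quat_integers"
    "quat_mult a b x y \<in> quat_integers"
proof -
  obtain k l where "x = Quat (of_int k) 0 0 0" "y = Quat (of_int l) 0 0 0"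
    using assms unfolding quat_integers_def by blast
  then have "x + y = Quat (of_int (k + l)) 0 0 0" "- x = Quat (of_int (- k)) 0 0 0"
      "x - y = Quat (of_int (k - l)) 0 0 0" "quat_mult a b x y = Quat (of_int (k * l)) 0 0 0"
    by (simp_all add: quat_group_defs)
  then show "x + y \<in> quat_integers" "- x \<in> quat_integers" "x - y \<in> quat_integers"
    "quat_mult a b x y \<in> quat_integers"
    unfolding quat_integers_def by blast+
qed

text \<open>
  The vertices of the polygon are listed linearly from a fixed vertex \<open>p\<close> onwards, and
  \<open>C p v\<close> are the entries on the fan of diagonals at \<open>p\<close>.
\<close>

locale frieze_fan =
  fixes a b :: rat and C :: "nat \<Rightarrow> nat \<Rightarrow> quat" and p :: nat
  assumes diagonal: "C r r = 0"
begin

text \<open>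
  The linear recurrence through the consecutive vertices \<open>u, v, w\<close> of a sub-polygon. Removing
  vertices makes signs appear, hence the factor \<open>\<epsilon>\<close>. The restriction \<open>r \<le> u\<close> avoids the other side of
  \<open>v\<close>, where entries enter with the opposite sign; the case \<open>r = u\<close>
  identifies \<open>q\<close>, and the case \<open>r = p\<close> gives the growth argument.
\<close>

definition spoke_relation :: "quat \<Rightarrow> nat \<Rightarrow> nat \<Rightarrow> nat \<Rightarrow> bool" where
  "spoke_relation q u v w \<longleftrightarrow>
     (\<exists>\<epsilon>\<in>quat_signs. \<forall>r\<in>{p..u}. C r w = quat_mult a b (C r v) q - quat_mult a b (C r u) \<epsilon>)"

lemma spoke_relationE:
  assumes "spoke_relation q u v w"
  obtains \<epsilon> where "\<epsilon> \<in> quat_signs"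
    "\<And>r. p \<le> r \<Longrightarrow> r \<le> u \<Longrightarrow> C r w = quat_mult a b (C r v) q - quat_mult a b (C r u) \<epsilon>"
  using assms unfolding spoke_relation_def by (meson atLeastAtMost_iff)

lemma spoke_relationI:
  assumes "\<epsilon> \<in> quat_signs"
    "\<And>r. p \<le> r \<Longrightarrow> r \<le> u \<Longrightarrow> C r w = quat_mult a b (C r v) q - quat_mult a b (C r u) \<epsilon>"
  shows "spoke_relation q u v w"
  using assms unfolding spoke_relation_def by (meson atLeastAtMost_iff)

fun unit_path :: "nat list \<Rightarrow> bool" where
  "unit_path (u # v # w # xs) \<longleftrightarrow>
     u < v \<and> C u v \<in> quat_signs \<and> (\<exists>q. spoke_relation q u v w) \<and> unit_path (v # w # xs)"
| "unit_path [u, v] \<longleftrightarrow> u < v \<and> C u v \<in> quat_signs"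
| "unit_path _ \<longleftrightarrow> True"

lemma spoke_relation_edge:
  assumes "spoke_relation q u v w" "p \<le> u"
  shows "C u w = quat_mult a b (C u v) q"
proof -
  obtain \<epsilon> where "C u w = quat_mult a b (C u v) q - quat_mult a b (C u u) \<epsilon>"
    using assms by (auto elim: spoke_relationE)
  then show ?thesis by (simp add: diagonal)
qed

lemma spoke_relation_middle:
  assumes "spoke_relation q u v w" "q \<in> quat_signs"
  obtains \<epsilon> where "\<epsilon> \<in> quat_signs"
    "\<And>r. p \<le> r \<Longrightarrow> r \<le> u \<Longrightarrow> C r v = quat_mult a b (C r w) q + quat_mult a b (C r u) \<epsilon>"
proof -
  obtain \<epsilon> where \<epsilon>: "\<epsilon> \<in> quat_signs"
    "\<And>r. p \<le> r \<Longrightarrow> r \<le> u \<Longrightarrow> C r w = quat_mult a b (C r v) q - quat_mult a b (C r u) \<epsilon>"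
    using spoke_relationE[OF assms(1)] by blast
  have "quat_mult a b x (quat_mult a b q q) = x" for x
    using assms(2) by auto
  then have "C r v = quat_mult a b (C r w) q + quat_mult a b (C r u) (quat_mult a b \<epsilon> q)"
    if "p \<le> r" "r \<le> u" for r
    by (simp add: \<epsilon>(2)[OF that] quat_mult_diff quat_mult_assoc)
  moreover have "quat_mult a b \<epsilon> q \<in> quat_signs" using \<epsilon>(1) assms(2) by auto
  ultimately show ?thesis using that by blast
qed

text \<open>
  When \<open>v\<close> is removed between \<open>u\<close> and \<open>w\<close>, the recurrences centred at its two neighbours
  change. This lemma treats the one centred at \<open>w\<close>, the next lemma the one centred at \<open>u\<close>.
  As for integer friezes, the quiddity entry of the neighbour changes by 1, up to signs.
\<close>

lemma spoke_relation_merge_right: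
  assumes "spoke_relation q u v w" "q \<in> quat_signs" "spoke_relation q' v w x" "u < v"
  shows "\<exists>q. spoke_relation q u w x"
proof -
  obtain \<epsilon> where \<epsilon>: "\<epsilon> \<in> quat_signs"
    "\<And>r. p \<le> r \<Longrightarrow> r \<le> u \<Longrightarrow> C r v = quat_mult a b (C r w) q + quat_mult a b (C r u) \<epsilon>"
    using spoke_relation_middle[OF assms(1,2)] by blast
  obtain \<epsilon>' where \<epsilon>': "\<epsilon>' \<in> quat_signs"
    "\<And>r. p \<le> r \<Longrightarrow> r \<le> v \<Longrightarrow> C r x = quat_mult a b (C r w) q' - quat_mult a b (C r v) \<epsilon>'"
    using spoke_relationE[OF assms(3)] by blast
  have "C r x = quat_mult a b (C r w) (q' - quat_mult a b q \<epsilon>')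
      - quat_mult a b (C r u) (quat_mult a b \<epsilon> \<epsilon>')"
    if "p \<le> r" "r \<le> u" for r
    using \<epsilon>'(2)[of r] \<epsilon>(2)[OF that] that assms(4)
    by (simp add: quat_mult_distrib quat_mult_diff quat_mult_assoc)
  moreover have "quat_mult a b \<epsilon> \<epsilon>' \<in> quat_signs" using \<epsilon>(1) \<epsilon>'(1) by auto
  ultimately show ?thesis by (blast intro: spoke_relationI)
qed

lemma spoke_relation_merge_left:
  assumes "spoke_relation q' t u v" "spoke_relation q u v w" "q \<in> quat_signs" "t < u"
  shows "\<exists>q. spoke_relation q t u w"
proof -
  obtain \<epsilon>' where \<epsilon>': "\<epsilon>' \<in> quat_signs"
    "\<And>r. p \<le> r \<Longrightarrow> r \<le> t \<Longrightarrow> C r v = quat_mult a b (C r u) q' - quat_mult a b (C r t) \<epsilon>'"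
    using spoke_relationE[OF assms(1)] by blast
  obtain \<epsilon> where \<epsilon>: "\<epsilon> \<in> quat_signs"
    "\<And>r. p \<le> r \<Longrightarrow> r \<le> u \<Longrightarrow> C r w = quat_mult a b (C r v) q - quat_mult a b (C r u) \<epsilon>"
    using spoke_relationE[OF assms(2)] by blast
  have "C r w = quat_mult a b (C r u) (quat_mult a b q' q - \<epsilon>)
      - quat_mult a b (C r t) (quat_mult a b \<epsilon>' q)"
    if "p \<le> r" "r \<le> t" for r
    using \<epsilon>(2)[of r] \<epsilon>'(2)[OF that] that assms(4)
    by (simp add: quat_mult_diff quat_mult_assoc)
  moreover have "quat_mult a b \<epsilon>' q \<in> quat_signs" using \<epsilon>'(1) assms(3) by auto
  ultimately show ?thesis by (blast intro: spoke_relationI)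
qed

lemma unit_path_tl: "unit_path (t # ys) \<Longrightarrow> unit_path ys"
  by (cases ys rule: unit_path.cases) simp_all

lemma unit_path_appendD: "unit_path (xs @ ys) \<Longrightarrow> unit_path ys"
  by (induction xs) (auto dest: unit_path_tl)

lemma unit_path_Cons_iff:
  "unit_path (t # u # ys) \<longleftrightarrow> t < u \<and> C t u \<in> quat_signs \<and>
     (ys \<noteq> [] \<longrightarrow> (\<exists>q. spoke_relation q t u (hd ys))) \<and> unit_path (u # ys)"
  by (cases ys) auto

lemma unit_path_delete:
  assumes "unit_path (xs @ u # v # w # ys)" "p \<le> u" "spoke_relation q u v w" "q \<in> quat_signs"
  shows "unit_path (xs @ u # w # ys)"
  using assms(1)
proof (induction xs)
  case Nil
  then have uv: "u < v" "C u v \<in> quat_signs" "unit_path (v # w # ys)" by (auto simp: unit_path_Cons_iff)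
  then have "v < w" "unit_path (w # ys)"
    and right: "ys \<noteq> [] \<Longrightarrow> \<exists>q'. spoke_relation q' v w (hd ys)" by (auto simp: unit_path_Cons_iff)
  moreover have "C u w \<in> quat_signs"
    unfolding spoke_relation_edge[OF assms(3,2)] using uv(2) assms(4) by auto
  moreover have "\<exists>q. spoke_relation q u w (hd ys)" if "ys \<noteq> []"
    using right[OF that] spoke_relation_merge_right[OF assms(3,4) _ uv(1)] by blast
  ultimately show ?case using uv(1) by (simp add: unit_path_Cons_iff)
next
  case (Cons t xs)
  have IH: "unit_path (xs @ u # w # ys)"
    using Cons.IH Cons.prems unit_path_tl by simp
  show ?case
  proof (cases xs)
    case Nil
    then obtain q' where "t < u" "C t u \<in> quat_signs" "spoke_relation q' t u v"
      using Cons.prems by (auto simp: unit_path_Cons_iff)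
    then show ?thesis
      using spoke_relation_merge_left[OF _ assms(3,4)] IH Nil by (auto simp: unit_path_Cons_iff)
  next
    case (Cons s xs')
    have "hd (xs' @ u # v # w # ys) = hd (xs' @ u # w # ys)" by (cases xs') auto
    then show ?thesis using Cons.prems IH Cons by (simp add: unit_path_Cons_iff)
  qed
qed

text \<open>
  If no quiddity entry along the path is small, the norm of the entries on the fan at \<open>p\<close> never
  decreases, and it increases as soon as there are three vertices. A path that closes up with an
  entry of norm at most 1 therefore contains a small quiddity entry.
\<close>

lemma spoke_norms_increase:
  assumes ab: "a < 0" "b < 0"
    and "unit_path (u # v # ws)" "p \<le> u" "quat_norm a b (C p u) < quat_norm a b (C p v)"
    and "\<And>xs u' v' w' ys q. u # v # ws = xs @ u' # v' # w' # ys \<Longrightarrow>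
      spoke_relation q u' v' w' \<Longrightarrow> 4 \<le> quat_norm a b q"
  shows "quat_norm a b (C p v) \<le> quat_norm a b (C p (last (v # ws))) \<and>
    (ws \<noteq> [] \<longrightarrow> quat_norm a b (C p v) < quat_norm a b (C p (last (v # ws))))"
  using assms(3-)
proof (induction ws arbitrary: u v)
  case (Cons w ws)
  from Cons.prems(1) obtain q where q: "spoke_relation q u v w" by auto
  have 4: "4 \<le> quat_norm a b q" by (rule Cons.prems(4)[OF _ q, of "[]"]) simp
  obtain \<epsilon> where "\<epsilon> \<in> quat_signs" "C p w = quat_mult a b (C p v) q - quat_mult a b (C p u) \<epsilon>"
    using spoke_relationE[OF q] Cons.prems(2) by (metis order_refl)
  then have w: "C p w = quat_mult a b (C p v) q - C p u \<or> C p w = quat_mult a b (C p v) q - (- C p u)"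
    by auto
  then have lt: "quat_norm a b (C p v) < quat_norm a b (C p w)"
    using quat_norm_grows[OF ab 4, of "C p u" "C p v"] quat_norm_grows[OF ab 4, of "- C p u" "C p v"]
      Cons.prems(3)
    by (metis quat_norm_uminus)
  have "quat_norm a b (C p w) \<le> quat_norm a b (C p (last (w # ws)))"
  proof (rule conjunct1, rule Cons.IH[of v])
    show "4 \<le> quat_norm a b q'" if "v # w # ws = xs @ u' # v' # w' # ys" "spoke_relation q' u' v' w'"
      for xs u' v' w' ys q'
      using Cons.prems(4)[of "u # xs" u' v' w' ys q'] that by simp
  qed (use Cons.prems lt in auto)
  then show ?case using lt by auto
qed simp

text \<open>
  Induction on the number of vertices: the growth argument provides a vertex \<open>x\<close> whose quiddity entry
  is a sign, the shorter path without \<open>x\<close> has integral entries, and the entry at \<open>x\<close> is a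
  signed sum of those at the neighbours of \<open>x\<close>.
\<close>

lemma unit_path_integral:
  assumes ab: "a < 0" "b < 0"
    and path: "unit_path vs" and range: "set vs \<subseteq> {p..<p + m}"
    and ends: "vs \<noteq> []" "hd vs = p" "C p (last vs) \<in> insert 0 quat_signs"
    and nonzero: "\<And>r s. p \<le> r \<Longrightarrow> r < s \<Longrightarrow> s < p + m \<Longrightarrow> quat_norm a b (C r s) < 4 \<Longrightarrow> C r s \<in> quat_signs"
  shows "v \<in> set vs \<Longrightarrow> C p v \<in> quat_integers"
  using path range ends
proof (induction vs arbitrary: v rule: length_induct)
  case (1 vs)
  have signs: "x \<in> quat_integers" if "x \<in> insert 0 quat_signs" for x
  proof -
    have "0 = Quat (of_int 0) 0 0 0" "quat_one = Quat (of_int 1) 0 0 0"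
        "- quat_one = Quat (of_int (- 1)) 0 0 0"
      by (simp_all add: quat_group_defs)
    then show ?thesis using that unfolding quat_integers_def by blast
  qed
  show ?case
  proof (cases "length vs \<le> 2")
    case True
    then have "v = hd vs \<or> v = last vs"
      using 1(2) by (cases vs rule: unit_path.cases) auto
    then show ?thesis using 1 signs by (metis diagonal insertI1)
  next
    case False
    then obtain u' v' ws where vs: "vs = u' # v' # ws" "ws \<noteq> []"
      by (cases vs rule: unit_path.cases) auto
    then have u': "u' = p" "C p v' \<in> quat_signs" using 1 by (auto simp: unit_path_Cons_iff)
    have n1: "quat_norm a b (C p v') = 1" using u' by (auto simp: quat_norm_def uminus_quat_def)
    have n0: "quat_norm a b (C p u') = 0" by (simp add: u' diagonal quat_norm_def zero_quat_def)
    have "quat_norm a b (C p (last vs)) \<le> 1"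
      using 1 by (auto simp: quat_norm_def zero_quat_def uminus_quat_def)
    then obtain xs u x w ys q where dec: "vs = xs @ u # x # w # ys" "spoke_relation q u x w"
        and small: "quat_norm a b q < 4"
      using spoke_norms_increase[OF ab, of u' v' ws] n0 n1 1 vs u'
      by (metis last_ConsR linorder_not_le list.distinct(1) order_refl zero_less_one)
    have path: "unit_path (u # x # w # ys)" using 1 dec unit_path_appendD by metis
    then have ux: "C u x \<in> quat_signs" "u < w" "p \<le> u" "w < p + m"
      using 1 dec by (auto simp: unit_path_Cons_iff)
    have uw: "C u w = quat_mult a b (C u x) q"
      by (rule spoke_relation_edge[OF dec(2) ux(3)])
    then have "C u w = q \<or> C u w = - q" using ux by auto
    moreover from this have "C u w \<in> quat_signs"
      by (intro nonzero) (use small ux in auto)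
    ultimately have q: "q \<in> quat_signs" by auto
    let ?vs = "xs @ u # w # ys"
    have path': "unit_path ?vs"
      by (rule unit_path_delete[OF _ ux(3) dec(2) q]) (use 1 dec in simp)
    have hd_last: "hd ?vs = p" "last ?vs = last vs" using 1 dec by (cases xs; auto)+
    have IH: "C p s \<in> quat_integers" if "s \<in> set ?vs" for s
      using 1(1)[rule_format, of ?vs s] path' hd_last dec 1 that by auto
    show ?thesis
    proof (cases "v = x")
      case False
      then show ?thesis using IH 1 dec by auto
    next
      case True
      obtain \<epsilon> where "\<epsilon> \<in> quat_signs"
          "C p x = quat_mult a b (C p w) q + quat_mult a b (C p u) \<epsilon>"
        using spoke_relation_middle[OF dec(2) q] ux(3) by (metis order_refl)
      moreover have "C p w \<in> quat_integers" "C p u \<in> quat_integers" using IH by auto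
      ultimately show ?thesis
        using signs[of q] signs[of \<epsilon>] q True by (simp only: quat_integers_closed insert_iff simp_thms)
    qed
  qed
qed

end

section \<open>Friezes with large parameters are integral\<close>

lemma quaternion_algebra_simps [simp]:
  "carrier (quaternion_algebra a b) = UNIV"
  "x \<otimes>\<^bsub>quaternion_algebra a b\<^esub> y = quat_mult (of_int a) (of_int b) x y"
  "x \<oplus>\<^bsub>quaternion_algebra a b\<^esub> y = x + y"
  "\<one>\<^bsub>quaternion_algebra a b\<^esub> = quat_one"
  "\<zero>\<^bsub>quaternion_algebra a b\<^esub> = 0"
  by (simp_all add: quaternion_algebra_def zero_quat_def plus_quat_def)

lemma lipschitz_ring_simps [simp]:
  "x \<otimes>\<^bsub>lipschitz_ring a b\<^esub> y = quat_mult (of_int a) (of_int b) x y"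
  "x \<oplus>\<^bsub>lipschitz_ring a b\<^esub> y = x + y"
  "\<one>\<^bsub>lipschitz_ring a b\<^esub> = quat_one"
  "\<zero>\<^bsub>lipschitz_ring a b\<^esub> = 0"
  by (simp_all add: lipschitz_ring_def quaternion_algebra_def zero_quat_def plus_quat_def)

lemma quaternion_algebra_uminus [simp]: "\<ominus>\<^bsub>quaternion_algebra a b\<^esub> x = - x"
proof -
  interpret ring "quaternion_algebra a b" by (rule quaternion_algebra_ring)
  show ?thesis by (rule minus_equality) simp_all
qed

text \<open>
  Generating inside the Lipschitz ring or inside the quaternion algebra gives the same subring;
  in the algebra, negation is visibly coordinatewise.
\<close>

lemma frieze_subring_in_algebra:
  "frieze_subring a b = generate_ring (quaternion_algebra a b)
     {c r s | m c r s. lipschitz_frieze a b m c \<and> (r, s) \<in> diag m}" (is "_ = generate_ring _ ?K")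
proof -
  interpret ring "quaternion_algebra a b" by (rule quaternion_algebra_ring)
  have "?K \<subseteq> carrier (lipschitz_ring a b)"
    unfolding lipschitz_frieze_def by auto
  then show ?thesis
    using subring_gen_equality[OF lipschitz_subring[of a b], of ?K]
    by (simp add: frieze_subring_def lipschitz_ring_def)
qed

lemma subring_quat_integers: "subring quat_integers (quaternion_algebra a b)"
proof -
  interpret ring "quaternion_algebra a b" by (rule quaternion_algebra_ring)
  have "quat_one = Quat (of_int 1) 0 0 0" by simp
  then have "quat_one \<in> quat_integers" unfolding quat_integers_def by blast
  then show ?thesis by (intro subringI) (auto intro: quat_integers_closed)
qed

lemma quat_integers_subset_subring:
  assumes "subring K (quaternion_algebra a b)"
  shows "quat_integers \<subseteq> K"
proof -
  have one: "quat_one \<in> K" and plus: "\<And>x y. x \<in> K \<Longrightarrow> y \<in> K \<Longrightarrow> x + y \<in> K"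
    and uminus: "\<And>x. x \<in> K \<Longrightarrow> - x \<in> K" and zero: "0 \<in> K"
    using subringE[OF assms] by simp_all
  have nat: "Quat (of_nat n) 0 0 0 \<in> K" for n
  proof (induction n)
    case 0
    then show ?case using zero by (simp add: zero_quat_def)
  next
    case (Suc n)
    then show ?case using plus[OF one Suc] by (simp add: plus_quat_def)
  qed
  have "Quat (of_int n) 0 0 0 \<in> K" for n
  proof (cases n)
    case (neg k)
    then show ?thesis using uminus[OF nat[of "Suc k"]] by (simp add: uminus_quat_def)
  qed (use nat in auto)
  then show ?thesis by (auto simp: quat_integers_def)
qed

text \<open>
  The fan is rooted at \<open>r\<close> itself, so that every entry with first index \<open>r\<close> lies on it.
\<close>

lemma lipschitz_frieze_integral:
  assumes ab: "a \<le> - 4" "b \<le> - 4" and frieze: "lipschitz_frieze a b m c" and rs: "(r, s) \<in> diag m"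
  shows "c r s \<in> quat_integers"
proof -
  interpret unit_frieze "quaternion_algebra a b" m c
    using frieze by (auto simp: lipschitz_frieze_def unit_frieze_def unit_frieze_axioms_def)
  have rsm: "r < m" "s < m" "r \<noteq> s" using rs by (auto simp: diag_def)
  interpret fan: frieze_fan "of_int a" "of_int b" entry r
    by unfold_locales (use entry_refl in simp)
  have rel: "fan.spoke_relation (entry u (Suc (Suc u))) u (Suc u) (Suc (Suc u))"
    if "r \<le> u" "Suc (Suc u) < r + m" for u
  proof (rule fan.spoke_relationI)
    show "quat_one \<in> quat_signs" by simp
    show "entry x (Suc (Suc u)) = quat_mult (of_int a) (of_int b) (entry x (Suc u)) (entry u (Suc (Suc u)))
        - quat_mult (of_int a) (of_int b) (entry x u) quat_one" if "r \<le> x" "x \<le> u" for x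
      using linear_recurrence[of u x "u - x"] that \<open>Suc (Suc u) < r + m\<close>
      by (simp add: eq_diff_eq)
  qed
  have path: "fan.unit_path [u..<u + k]" if "r \<le> u" "u + k \<le> r + m" for u k
    using that
  proof (induction k arbitrary: u)
    case (Suc k)
    show ?case
    proof (cases "k = 0")
      case False
      have "[u..<u + Suc k] = u # [Suc u..<Suc u + k]" by (simp add: upt_rec)
      moreover have "[Suc u..<Suc u + k] = Suc u # [Suc (Suc u)..<Suc u + k]"
        using False by (simp add: upt_rec)
      moreover have "[Suc (Suc u)..<Suc u + k] \<noteq> [] \<Longrightarrow>
          Suc (Suc u) < r + m \<and> hd [Suc (Suc u)..<Suc u + k] = Suc (Suc u)"
        using Suc.prems by (simp del: upt_Suc)
      moreover have "fan.unit_path [Suc u..<Suc u + k]"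
        using Suc.IH[of "Suc u"] Suc.prems by (simp del: upt_Suc)
      moreover have "entry u (Suc u) \<in> quat_signs" by simp
      ultimately show ?thesis using Suc.prems rel[of u]
        by (metis fan.unit_path_Cons_iff lessI)
    qed simp
  qed simp
  \<comment> \<open>The position of \<open>s\<close> on the path that starts at \<open>r\<close>.\<close>
  define d where "d = (if r \<le> s then s - r else m + s - r)"
  have d: "d < m" "(r + d) mod m = s" "r + d \<in> set [r..<r + m]"
    using rsm by (auto simp: d_def)
  have "entry r (r + d) \<in> quat_integers"
  proof (rule fan.unit_path_integral[of "[r..<r + m]" m])
    show "fan.unit_path [r..<r + m]" by (rule path) auto
    show "entry u v \<in> quat_signs"
      if "r \<le> u" "u < v" "v < r + m" "quat_norm (of_int a) (of_int b) (entry u v) < 4" for u v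
    proof (rule lipschitz_small_norm_sign[OF ab _ _ that(4)])
      have "u mod m \<noteq> v mod m" using mod_add_neq[of 0 "v - u" u] that by simp
      from entry_diag[OF this] frieze
      show "entry u v \<in> carrier (lipschitz_ring a b)" "entry u v \<noteq> 0"
        by (auto simp: lipschitz_frieze_def)
    qed
    \<comment> \<open>The last vertex of the path is the predecessor of \<open>r\<close> on the polygon.\<close>
  have "entry r (r + m - 1) = entry (Suc (r + m - 1)) (r + m - 1)" 
      using m_pos by (simp add: entry_def)
    also have "\<dots> = quat_one" using entry_Suc(2)[of "r + m - 1"] by simp
    finally show "entry r (last [r..<r + m]) \<in> insert 0 quat_signs"
      using m_pos by simp
  qed (use ab m_pos d in auto)
  then show ?thesis using entry_diag[of r "r + d"] d rsm by simp
qed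

section \<open>Friezes on the square and the hexagon\<close>

context skew_field
begin

definition square_frieze :: "'a \<Rightarrow> 'a \<Rightarrow> nat \<Rightarrow> nat \<Rightarrow> 'a" where
  "square_frieze p q r s = (if odd (r + s) then \<one> else if even r then p else q)"

text \<open>
  The long diagonals carry \<open>p q - 1 = 2\<close>.
\<close>

definition hexagon_frieze :: "'a \<Rightarrow> 'a \<Rightarrow> nat \<Rightarrow> nat \<Rightarrow> 'a" where
  "hexagon_frieze p q r s =
     (if odd (r + s) then if r = s + 3 \<or> s = r + 3 then \<one> \<oplus> \<one> else \<one> else if even r then p else q)"

lemma Units_nonzero: "x \<in> Units D \<Longrightarrow> x \<in> carrier D \<and> x \<noteq> \<zero>"
  using skew_field_Units by auto

lemma next_of_square_vertex:
  assumes "r < 4"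
  shows "(r, nxt 4 r) \<in> {(0, 1), (1, 2), (2, 3), (3, 0)}"
proof -
  consider "r = 0" | "r = 1" | "r = 2" | "r = 3" using assms by linarith
  then show ?thesis by cases simp_all
qed

lemma next_of_hexagon_vertex:
  assumes "r < 6"
  shows "(r, nxt 6 r) \<in> {(0, 1), (1, 2), (2, 3), (3, 4), (4, 5), (5, 0)}"
proof -
  consider "r = 0" | "r = 1" | "r = 2" | "r = 3" | "r = 4" | "r = 5" using assms by linarith
  then show ?thesis by cases simp_all
qed

lemma square_frieze_boundary:
  assumes "r < 4"
  shows "square_frieze p q r (nxt 4 r) = \<one>" "square_frieze p q (nxt 4 r) r = \<one>"
  using next_of_square_vertex[OF assms] by (auto simp: square_frieze_def simp del: mod_less)

lemma hexagon_frieze_boundary: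
  assumes "r < 6"
  shows "hexagon_frieze p q r (nxt 6 r) = \<one>" "hexagon_frieze p q (nxt 6 r) r = \<one>"
  using next_of_hexagon_vertex[OF assms] by (auto simp: hexagon_frieze_def simp del: mod_less)

text \<open>
  Every exchange relation reads \<open>p = q\<^sup>-\<^sup>1 + q\<^sup>-\<^sup>1\<close> or \<open>q = p\<^sup>-\<^sup>1 + p\<^sup>-\<^sup>1\<close>.
\<close>

lemma nc_frieze_square:
  assumes pq: "p \<in> Units D" "q \<in> Units D" "p \<otimes> q = \<one> \<oplus> \<one>" "q \<otimes> p = \<one> \<oplus> \<one>"
  shows "nc_frieze D 4 (square_frieze p q)"
proof
  have one: "\<one> \<noteq> \<zero>" using Units_nonzero Units_one_closed by blast
  note cl = Units_closed[OF pq(1)] Units_closed[OF pq(2)]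
    Units_inv_closed[OF pq(1)] Units_inv_closed[OF pq(2)]
  have double: "inv y \<oplus> inv y = x"
    if "x \<in> Units D" "y \<in> Units D" "x \<otimes> y = \<one> \<oplus> \<one>" for x y
  proof -
    have "x \<otimes> y \<otimes> inv y = x" using that(1,2) by (simp add: m_assoc Units_closed)
    then show ?thesis using that(2) unfolding that(3) by (simp add: l_distr)
  qed
  have sums: "inv q \<oplus> inv q = p" "inv p \<oplus> inv p = q" using double pq by blast+
  show "3 \<le> (4::nat)" by simp
  fix r s :: nat
  show "square_frieze p q r s \<in> carrier D - {\<zero>}"
    using pq Units_nonzero one by (simp add: square_frieze_def)
  fix r1 s1 r2
  show "square_frieze p q r1 r2 \<otimes> inv square_frieze p q r r2 \<otimes> square_frieze p q r r1 =
       square_frieze p q r1 r \<otimes> inv square_frieze p q r2 r \<otimes> square_frieze p q r2 r1"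
    if "r < 4" "r1 = nxt 4 r" "r2 = nxt 4 r1"
  proof -
    have "(r, r1) \<in> {(0, 1), (1, 2), (2, 3), (3, 0)}" "(r1, r2) \<in> {(0, 1), (1, 2), (2, 3), (3, 0)}"
      unfolding that(2,3) by (intro next_of_square_vertex that(1) mod_less_divisor; simp)+
    then show ?thesis
      by (elim insertE emptyE Pair_inject) (simp_all add: square_frieze_def cl)
  qed
  assume *: "r < 4" "s < 4" "r1 = nxt 4 r" "s1 = nxt 4 s" "distinct [r, r1, s, s1]"
  have "(r, r1) \<in> {(0, 1), (1, 2), (2, 3), (3, 0)}" "(s, s1) \<in> {(0, 1), (1, 2), (2, 3), (3, 0)}"
    unfolding *(3,4) by (fact next_of_square_vertex[OF *(1)] next_of_square_vertex[OF *(2)])+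
  then have "(r, r1, s, s1) \<in> {(0, 1, 2, 3), (1, 2, 3, 0), (2, 3, 0, 1), (3, 0, 1, 2)}"
    using *(5) by (elim insertE emptyE Pair_inject) simp_all
  then show "square_frieze p q s r = square_frieze p q s s1 \<otimes> inv square_frieze p q r1 s1 \<otimes>
          square_frieze p q r1 r \<oplus>
        square_frieze p q s r1 \<otimes> inv square_frieze p q s1 r1 \<otimes> square_frieze p q s1 r \<and>
      square_frieze p q r s = square_frieze p q r r1 \<otimes> inv square_frieze p q s1 r1 \<otimes> square_frieze p q s1 s \<oplus>
        square_frieze p q r s1 \<otimes> inv square_frieze p q r1 s1 \<otimes> square_frieze p q r1 s \<and>
      square_frieze p q r1 s1 = square_frieze p q r1 r \<otimes> inv square_frieze p q s r \<otimes> square_frieze p q s s1 \<oplus>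
        square_frieze p q r1 s \<otimes> inv square_frieze p q r s \<otimes> square_frieze p q r s1 \<and>
      square_frieze p q s1 r1 = square_frieze p q s1 s \<otimes> inv square_frieze p q r s \<otimes> square_frieze p q r r1 \<oplus>
        square_frieze p q s1 r \<otimes> inv square_frieze p q s r \<otimes> square_frieze p q s r1"
    by (elim insertE emptyE Pair_inject) (simp_all add: square_frieze_def cl sums)
qed

text \<open>
  The exchange relations reduce to \<open>p = 3 q\<^sup>-\<^sup>1\<close>, to \<open>q = 3 p\<^sup>-\<^sup>1\<close> and, for two long diagonals,
  to \<open>2 = 2\<^sup>-\<^sup>1 + p 2\<^sup>-\<^sup>1 q\<close>, that is \<open>4 = 1 + 3\<close>.
\<close>

lemma nc_frieze_hexagon:
  assumes pq: "p \<in> Units D" "q \<in> Units D" "p \<otimes> q = \<one> \<oplus> \<one> \<oplus> \<one>" "q \<otimes> p = \<one> \<oplus> \<one> \<oplus> \<one>"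
    and two: "\<one> \<oplus> \<one> \<in> Units D"
  shows "nc_frieze D 6 (hexagon_frieze p q)"
proof
  define t where "t = \<one> \<oplus> \<one>"
  have t: "t \<in> Units D" using two by (simp add: t_def)
  have one: "\<one> \<noteq> \<zero>" using Units_nonzero Units_one_closed by blast
  note cl = Units_closed[OF pq(1)] Units_closed[OF pq(2)]
    Units_inv_closed[OF pq(1)] Units_inv_closed[OF pq(2)]
    Units_closed[OF t] Units_inv_closed[OF t]
  have triple: "inv y \<oplus> inv y \<otimes> t = x" "inv y \<oplus> t \<otimes> inv y = x"
    if "x \<in> Units D" "y \<in> Units D" "x \<otimes> y = \<one> \<oplus> \<one> \<oplus> \<one>" for x y
  proof -
    have "x \<otimes> y \<otimes> inv y = x" using that(1,2) by (simp add: m_assoc Units_closed)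
    then have "inv y \<oplus> inv y \<oplus> inv y = x" using that(2) unfolding that(3) by (simp add: l_distr)
    then show "inv y \<oplus> inv y \<otimes> t = x" "inv y \<oplus> t \<otimes> inv y = x"
      using that by (simp_all add: t_def l_distr r_distr a_assoc)
  qed
  have four: "inv t \<oplus> x \<otimes> inv t \<otimes> y = t"
    if "x \<in> Units D" "y \<in> Units D" "x \<otimes> y = \<one> \<oplus> \<one> \<oplus> \<one>" for x y
  proof -
    have xc: "x \<in> carrier D" "y \<in> carrier D" using that by auto
    \<comment> \<open>An integer is central, so \<open>t\<close> can be moved past \<open>x\<close>.\<close>
    have "t \<otimes> x = x \<otimes> t" using xc by (simp add: t_def l_distr r_distr)
    then have "t \<otimes> (inv t \<oplus> x \<otimes> inv t \<otimes> y) = \<one> \<oplus> x \<otimes> y"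
      using xc t cl(5-6) by (simp add: r_distr m_assoc[symmetric]) (simp add: m_assoc)
    also have "\<dots> = t \<otimes> t"
      by (simp add: that t_def l_distr a_assoc)
    finally show ?thesis using xc t cl(5-6) by simp
  qed
  have sums: "inv q \<oplus> inv q \<otimes> t = p" "inv q \<oplus> t \<otimes> inv q = p"
      "inv p \<oplus> inv p \<otimes> t = q" "inv p \<oplus> t \<otimes> inv p = q"
      "inv t \<oplus> p \<otimes> inv t \<otimes> q = t" "inv t \<oplus> q \<otimes> inv t \<otimes> p = t"
    using triple[OF pq(1-3)] triple[OF pq(2,1,4)] four[OF pq(1-3)] four[OF pq(2,1,4)] by auto
  show "3 \<le> (6::nat)" by simp
  fix r s :: nat
  show "hexagon_frieze p q r s \<in> carrier D - {\<zero>}"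
    using pq t Units_nonzero one by (simp add: hexagon_frieze_def t_def)
  fix r1 s1 r2
  show "hexagon_frieze p q r1 r2 \<otimes> inv hexagon_frieze p q r r2 \<otimes> hexagon_frieze p q r r1 =
       hexagon_frieze p q r1 r \<otimes> inv hexagon_frieze p q r2 r \<otimes> hexagon_frieze p q r2 r1"
    if "r < 6" "r1 = nxt 6 r" "r2 = nxt 6 r1"
  proof -
    have "(r, r1) \<in> {(0, 1), (1, 2), (2, 3), (3, 4), (4, 5), (5, 0)}"
      "(r1, r2) \<in> {(0, 1), (1, 2), (2, 3), (3, 4), (4, 5), (5, 0)}"
      unfolding that(2,3) by (intro next_of_hexagon_vertex that(1) mod_less_divisor; simp)+
    then show ?thesis
      by (elim insertE emptyE Pair_inject) (simp_all add: hexagon_frieze_def cl)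
  qed
  assume *: "r < 6" "s < 6" "r1 = nxt 6 r" "s1 = nxt 6 s" "distinct [r, r1, s, s1]"
  have "(r, r1) \<in> {(0, 1), (1, 2), (2, 3), (3, 4), (4, 5), (5, 0)}"
      "(s, s1) \<in> {(0, 1), (1, 2), (2, 3), (3, 4), (4, 5), (5, 0)}"
    unfolding *(3,4) by (fact next_of_hexagon_vertex[OF *(1)] next_of_hexagon_vertex[OF *(2)])+
  then have "(r, r1, s, s1) \<in> {(0, 1, 2, 3), (0, 1, 3, 4), (0, 1, 4, 5),
      (1, 2, 3, 4), (1, 2, 4, 5), (1, 2, 5, 0), (2, 3, 4, 5), (2, 3, 5, 0), (2, 3, 0, 1),
      (3, 4, 5, 0), (3, 4, 0, 1), (3, 4, 1, 2), (4, 5, 0, 1), (4, 5, 1, 2), (4, 5, 2, 3),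
      (5, 0, 1, 2), (5, 0, 2, 3), (5, 0, 3, 4)}"
    using *(5) by (elim insertE emptyE Pair_inject) simp_all
  then show "hexagon_frieze p q s r = hexagon_frieze p q s s1 \<otimes> inv hexagon_frieze p q r1 s1 \<otimes>
          hexagon_frieze p q r1 r \<oplus>
        hexagon_frieze p q s r1 \<otimes> inv hexagon_frieze p q s1 r1 \<otimes> hexagon_frieze p q s1 r \<and>
      hexagon_frieze p q r s = hexagon_frieze p q r r1 \<otimes> inv hexagon_frieze p q s1 r1 \<otimes> hexagon_frieze p q s1 s \<oplus>
        hexagon_frieze p q r s1 \<otimes> inv hexagon_frieze p q r1 s1 \<otimes> hexagon_frieze p q r1 s \<and>
      hexagon_frieze p q r1 s1 = hexagon_frieze p q r1 r \<otimes> inv hexagon_frieze p q s r \<otimes> hexagon_frieze p q s s1 \<oplus>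
        hexagon_frieze p q r1 s \<otimes> inv hexagon_frieze p q r s \<otimes> hexagon_frieze p q r s1 \<and>
      hexagon_frieze p q s1 r1 = hexagon_frieze p q s1 s \<otimes> inv hexagon_frieze p q r s \<otimes> hexagon_frieze p q r r1 \<oplus>
        hexagon_frieze p q s1 r \<otimes> inv hexagon_frieze p q s r \<otimes> hexagon_frieze p q s r1"
    by (elim insertE emptyE Pair_inject) (simp_all add: hexagon_frieze_def t_def[symmetric] cl sums)
qed

end

text \<open>
  Here \<open>p, q\<close> alternate in the quiddity cycle: on the square for \<open>n = 2\<close>, on the hexagon for \<open>n = 3\<close>.
\<close>

lemma alternating_entry_in_frieze_subring:
  assumes ab: "a < 0" "b < 0"
    and L: "p \<in> carrier (lipschitz_ring a b)" "q \<in> carrier (lipschitz_ring a b)"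
    and n: "n = 2 \<or> n = 3"
    and pq: "quat_mult (of_int a) (of_int b) p q = Quat n 0 0 0"
      "quat_mult (of_int a) (of_int b) q p = Quat n 0 0 0"
  shows "p \<in> frieze_subring a b"
proof -
  interpret skew_field "quaternion_algebra a b" by (rule quaternion_algebra_skew_field[OF ab])
  have "p \<noteq> 0" "q \<noteq> 0" using pq n by (auto simp: zero_quat_def[symmetric]) (auto simp: zero_quat_def)
  then have U: "p \<in> Units (quaternion_algebra a b)" "q \<in> Units (quaternion_algebra a b)"
    by (simp_all add: skew_field_Units)
  have one: "quat_one \<noteq> 0" "quat_one \<in> carrier (lipschitz_ring a b)"
    using subringE(3)[OF lipschitz_subring[of a b]] by (simp_all add: zero_quat_def)
  have two: "quat_one + quat_one \<noteq> 0"
      "quat_one + quat_one \<in> carrier (lipschitz_ring a b)"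
    using subringE(7)[OF lipschitz_subring[of a b] one(2) one(2)] by (simp_all add: zero_quat_def plus_quat_def)
  have "\<exists>m c r s. lipschitz_frieze a b m c \<and> (r, s) \<in> diag m \<and> c r s = p"
  proof (cases "n = 2")
    case True
    have "nc_frieze (quaternion_algebra a b) 4 (square_frieze p q)"
      using nc_frieze_square[OF U] pq True by (simp add: plus_quat_def)
    then have "lipschitz_frieze a b 4 (square_frieze p q)"
      using L one \<open>p \<noteq> 0\<close> \<open>q \<noteq> 0\<close> square_frieze_boundary[of _ p q]
      by (simp add: lipschitz_frieze_def) (simp add: square_frieze_def)
    then show ?thesis
      by (intro exI[of _ 4] exI[of _ "square_frieze p q"] exI[of _ 0] exI[of _ 2])
        (simp add: diag_def square_frieze_def)
  next
    case False
    have "nc_frieze (quaternion_algebra a b) 6 (hexagon_frieze p q)"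
      using nc_frieze_hexagon[OF U] pq False n two by (simp add: plus_quat_def skew_field_Units)
    then have "lipschitz_frieze a b 6 (hexagon_frieze p q)"
      using L one two \<open>p \<noteq> 0\<close> \<open>q \<noteq> 0\<close> hexagon_frieze_boundary[of _ p q]
      by (simp add: lipschitz_frieze_def) (simp add: hexagon_frieze_def)
    then show ?thesis
      by (intro exI[of _ 6] exI[of _ "hexagon_frieze p q"] exI[of _ 0] exI[of _ 2])
        (simp add: diag_def hexagon_frieze_def)
  qed
  then show ?thesis unfolding frieze_subring_def by (blast intro: generate_ring.incl)
qed

lemma subring_frieze_subring: "subring (frieze_subring a b) (quaternion_algebra a b)"
proof -
  interpret ring "quaternion_algebra a b" by (rule quaternion_algebra_ring)
  show ?thesis unfolding frieze_subring_in_algebra by (rule generate_ring_is_subring) simp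
qed

lemma lipschitz_ring_memI:
  "Quat (of_int \<alpha>) (of_int \<beta>) (of_int \<gamma>) (of_int \<delta>) \<in> carrier (lipschitz_ring a b)"
  by (auto simp: lipschitz_ring_def)

lemma imaginary_unit_in_frieze_subring:
  assumes ab: "a < 0" "b < 0"
    and e: "e = Quat 0 1 0 0 \<and> d = a \<or> e = Quat 0 0 1 0 \<and> d = b" and d: "- 3 \<le> d"
  shows "e \<in> frieze_subring a b"
proof -
  let ?mult = "quat_mult (of_int a) (of_int b)"
  have eL: "e \<in> carrier (lipschitz_ring a b)"
    using e lipschitz_ring_memI[of 0 1 0 0] lipschitz_ring_memI[of 0 0 1 0] by auto
  note closed = subringE[OF lipschitz_subring[of a b], simplified]
  note F = subringE[OF subring_frieze_subring[of a b], simplified]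
  have sq: "?mult e e = Quat (of_int d) 0 0 0" using e by auto
  consider "d = - 1" | "d = - 2 \<or> d = - 3" using d e ab by linarith
  then show ?thesis
  proof cases
    case 1
    have "quat_one + e \<in> frieze_subring a b"
    proof (rule alternating_entry_in_frieze_subring[OF ab, of _ "quat_one + - e" 2])
      show "quat_one + e \<in> carrier (lipschitz_ring a b)"
          "quat_one + - e \<in> carrier (lipschitz_ring a b)"
        using closed eL by blast+
      show "?mult (quat_one + e) (quat_one + - e) = Quat 2 0 0 0"
          "?mult (quat_one + - e) (quat_one + e) = Quat 2 0 0 0"
        using e 1 by (auto simp: plus_quat_def uminus_quat_def)
    qed simp
    then have "(quat_one + e) + - quat_one \<in> frieze_subring a b" using F by blast
    then show ?thesis by simp
  next
    case 2
    show ?thesis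
    proof (rule alternating_entry_in_frieze_subring[OF ab, of _ "- e" "- of_int d"])
      show "e \<in> carrier (lipschitz_ring a b)" "- e \<in> carrier (lipschitz_ring a b)"
        using closed eL by blast+
      show "?mult e (- e) = Quat (- of_int d) 0 0 0" "?mult (- e) e = Quat (- of_int d) 0 0 0"
        by (simp_all only: quat_mult_uminus sq) (simp_all add: uminus_quat_def)
    qed (use 2 in auto)
  qed
qed

theorem theorem5p8:
  fixes a b :: int
  assumes "a < 0" and "b < 0"
  shows "(a \<le> - 4 \<and> b \<le> - 4 \<longrightarrow> frieze_subring a b = quat_integers) \<and>
         (a \<ge> - 3 \<and> b \<ge> - 3 \<longrightarrow> frieze_subring a b = carrier (lipschitz_ring a b))"
proof (intro conjI impI)
  interpret ring "quaternion_algebra a b" by (rule quaternion_algebra_ring)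
  note F = subringE[OF subring_frieze_subring[of a b], simplified]
  note integers = quat_integers_subset_subring[OF subring_frieze_subring[of a b]]
  show "frieze_subring a b = quat_integers" if "a \<le> - 4 \<and> b \<le> - 4"
  proof (rule antisym[OF _ integers])
    show "frieze_subring a b \<subseteq> quat_integers"
      unfolding frieze_subring_in_algebra
      by (rule generate_ring_min_subring1[OF _ subring_quat_integers])
        (use that lipschitz_frieze_integral in auto)
  qed
  assume "a \<ge> - 3 \<and> b \<ge> - 3"
  then have i: "Quat 0 1 0 0 \<in> frieze_subring a b" and j: "Quat 0 0 1 0 \<in> frieze_subring a b"
    using imaginary_unit_in_frieze_subring[OF assms] by blast+
  show "frieze_subring a b = carrier (lipschitz_ring a b)"
  proof
    show "frieze_subring a b \<subseteq> carrier (lipschitz_ring a b)"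
      unfolding frieze_subring_in_algebra
      by (rule generate_ring_min_subring1[OF _ lipschitz_subring]) (auto simp: lipschitz_frieze_def)
    show "carrier (lipschitz_ring a b) \<subseteq> frieze_subring a b"
    proof
      fix x assume "x \<in> carrier (lipschitz_ring a b)"
      then obtain \<alpha> \<beta> \<gamma> \<delta> :: int where x: "x = Quat (of_int \<alpha>) (of_int \<beta>) (of_int \<gamma>) (of_int \<delta>)"
        by (auto simp: lipschitz_ring_def)
      let ?mult = "quat_mult (of_int a) (of_int b)"
      let ?n = "\<lambda>n. Quat (of_int n) 0 0 0"
      have n: "?n k \<in> frieze_subring a b" for k using integers by (auto simp: quat_integers_def)
      \<comment> \<open>The generators reach every coordinate, since \<open>k = i j\<close>.\<close>
      have "x = ?n \<alpha> + ?mult (?n \<beta>) (Quat 0 1 0 0) + ?mult (?n \<gamma>) (Quat 0 0 1 0)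
          + ?mult (?n \<delta>) (?mult (Quat 0 1 0 0) (Quat 0 0 1 0))"
        by (simp add: x plus_quat_def)
      then show "x \<in> frieze_subring a b"
        by (simp only: F n i j)
    qed
  qed
qed

end
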